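(* Let $d\in\mathbb{N}$, $D=\mathbb{R}^d\times(0,+\infty)$, and let $N$ be a manifold in $D$. Let $\overline A=(A_1\ A_2)$, $\overline A(f,g)=A_1f+A_2g$, be the solution operator of the Cauchy problem $\frac{\partial x}{\partial t}-\Delta x=f$ in $D$, $x(v,0)=g(v)$, $v\in\mathbb{R}^d$, given, for $(u,t)\in N$, by $$(A_1f)(u,t)=\int_0^t\!\int_{\mathbb{R}^d}\frac{\exp\left(-\frac{|u-v|^2}{4(t-s)}\right)}{(4\pi(t-s))^{d/2}}f(v,s)\,d\mu(v,s),\qquad(A_2g)(u,t)=\int_{\mathbb{R}^d}\frac{\exp\left(-\frac{|u-v|^2}{4t}\right)}{(4\pi t)^{d/2}}g(v)\,d\mu(v).$$ Let $M_1\subset D$, $M_2\subset\mathbb{R}^d$ be compact sets, $\omega_1,\omega_2$ moduli of continuity, $W_i=\tilde H^{\omega_i}_\mu(M_i)$, $Q_i\subset M_i$ sets of $n_i\in\mathbb{N}$ points, $e_i\in\mathbb{R}^{n_i}_+$, $I_i=I_{Q_i}$, $U_i=U_{e_i}$, $L_i=\tilde L_{\omega_i,Q_i,e_i}$, $\tau_i=\tilde\tau_{\omega_i,Q_i,e_i}$, $i=1,2$, and $\overline W=W_1\times W_2$, $\overline I=\mathrm{diag}(I_1,I_2)$, $\overline U=U_1\times U_2$. Let $Y\subset\mathfrak{M}(N,\mu)$ be a normed lattice containing the space of $\mu$-essentially bounded and integrable functions on $N$, and such that $A_i(B_\mu(M_i))\subset Y$, $i=1,2$. Then $\Phi=\overline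 A\,\overline L$, $\overline L=\mathrm{diag}(L_1,L_2)$, is an optimal method of recovery of the operator $\overline A$ on the class $\overline W$ based on information $\overline I$ with $\overline U$-error, and $$\mathcal{E}(\overline A;\overline W;\overline I;\overline U)=\mathcal{E}(\overline A;\overline W;\overline I;\overline U;\Phi)=\|\overline A\,\overline\tau\|_Y,\qquad\overline\tau=\tau_1\times\tau_2,\quad\overline A\,\overline\tau=A_1\tau_1+A_2\tau_2.$$
   Context: $\mu$ denotes Lebesgue measure of the dimension of the set or manifold on which it is considered ($(d+1)$-dimensional on $D$, $d$-dimensional on $\mathbb{R}^d$, the natural $k$-dimensional measure on a $k$-dimensional manifold $N$; unit point mass if $N$ is a point). $|\cdot|$ is the Euclidean norm, $\Delta$ is the Laplacian in the space variables. $D$ and $\mathbb{R}^d$ carry the Euclidean metric. $\mathbb{R}_+=[0,\infty)$. A modulus of continuity is a continuous non-decreasing $\omega:\mathbb{R}_+\to\mathbb{R}_+$ with $\omega(0)=0$ and $\omega(t'+t'')\le\omega(t')+\omega(t'')$. For $M=D$ or $M=\mathbb{R}^d$ with Euclidean metric $\rho$ and compact $M'\subset M$: $B_\mu(M')$ is the set of $\mu$-essentially bounded functions on $M$ with support in $M'$; $\tilde H^\omega_\mu(M')$ is the set of continuous $x:M\to\mathbb{R}$ with $\mathrm{supp}\,x\subset M'$ and $|x(t')-x(t'')|\le\omega(\rho(t',t''))$ for all $t',t''\in M'$. For $Q=\{q_1,\dots,q_n\}\subset M'$ and $e=(e^1,\dots,e^n)\in\mathbb{R}^n_+$: $I_Qx=(x(q_1),\dots,x(q_n))$;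 $U_e=[-e^1,e^1]\times\dots\times[-e^n,e^n]$; $\tau(t)=\min_{1\le j\le n}(e^j+\omega(\rho(t,q_j)))$ for $t\in M'$, $\tau(t)=0$ otherwise; $\tilde\tau_{\omega,Q,e}(t)=\min\{\tau(t),\omega(\rho(t,\partial M'))\}$, where $\rho(t,\partial M')$ is the distance to the boundary of $M'$; $\Pi'_j=\{t\in M':\tau(t)=e^j+\omega(\rho(t,q_j))\}$, $\Pi_1=\Pi'_1$, $\Pi_j=\Pi'_j\setminus\bigcup_{s<j}\Pi_s$, $\tilde\Pi_0=\{t\in M':\omega(\rho(t,\partial M'))\le\tau(t)\}$, $\tilde\Pi_j=\Pi_j\setminus\tilde\Pi_0$; $\tilde L_{\omega,Q,e}z(t)=z_j$ for $t\in\tilde\Pi_j$, $j\ge1$, and $0$ for $t\in\tilde\Pi_0\cup(M\setminus M')$, $z\in\mathbb{R}^n$. $\mathfrak{M}(N,\mu)$ is the space of measurable a.e. finite functions on $N$ modulo a.e. equality, ordered by $x'\prec x''$ iff $x'\le x''$ a.e. A normed lattice $Y\subset\mathfrak{M}(N,\mu)$ is a normed space which is a vector lattice for the inherited order with $|x|\prec|y|\Rightarrow\|x\|_Y\le\|y\|_Y$. $\overline I(f,g)=(I_1f,I_2g)$; $\overline A\,\overline L(z_1,z_2)=A_1L_1z_1+A_2L_2z_2$. A method of recovery is an arbitrary map $\Phi:\mathbb{R}^{n_1}\times\mathbb{R}^{n_2}\to Y$; $\mathcal{E}(\overline A;\overline W;\overline I;\overline U;\Phi)=\sup_{\overline x\in\overline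 W}\sup_{\overline z\in\overline I\,\overline x+\overline U}\|\overline A\,\overline x-\Phi\overline z\|_Y$; $\mathcal{E}(\overline A;\overline W;\overline I;\overline U)$ is its infimum over $\Phi$; a method is optimal if it attains this infimum. *)

theory Defs
  imports "HOL-Analysis.Analysis"
begin

definition C1_on :: "('a::euclidean_space \<Rightarrow> 'b::euclidean_space) \<Rightarrow> 'a set \<Rightarrow> bool" where
  "C1_on f U \<longleftrightarrow> (\<exists>f' :: 'a \<Rightarrow> 'a \<Rightarrow>\<^sub>L 'b.
     (\<forall>x\<in>U. (f has_derivative blinfun_apply (f' x)) (at x)) \<and> continuous_on U f')"

text \<open>
  An embedded \<open>k\<close>-dimensional submanifold without boundary, of class \<open>C\<^sup>1\<close> (the least smoothness
  under which it carries a natural \<open>k\<close>-dimensional measure), described by local charts that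
  straighten it to a linear subspace.
\<close>

definition C1_submanifold :: "nat \<Rightarrow> 'a::euclidean_space set \<Rightarrow> bool" where
  "C1_submanifold k N \<longleftrightarrow> (\<forall>p\<in>N. \<exists>U V S \<phi> \<psi>.
     open U \<and> p \<in> U \<and> open V \<and> homeomorphism U V \<phi> \<psi> \<and> C1_on \<phi> U \<and> C1_on \<psi> V \<and>
     subspace (S :: 'a set) \<and> dim S = k \<and> \<phi> ` (N \<inter> U) = S \<inter> V)"

text \<open>
  The \<open>k\<close>-dimensional measure on a \<open>k\<close>-dimensional submanifold is the Hausdorff measure, normalised
  by the volume of the unit ball so that it agrees with Lebesgue measure on linear subspaces.
  Note \<open>0 ^ 0 = 1\<close>: for \<open>k = 0\<close> nonempty sets have weight 1, which gives counting measure.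
\<close>

definition hausdorff_weight :: "nat \<Rightarrow> 'a::metric_space set \<Rightarrow> ennreal" where
  "hausdorff_weight k C =
     (if C = {} then 0 else ennreal (unit_ball_vol (real k) * (diameter C / 2) ^ k))"

definition hausdorff_covers :: "real \<Rightarrow> 'a::metric_space set \<Rightarrow> (nat \<Rightarrow> 'a set) set" where
  "hausdorff_covers \<delta> A =
     {C. A \<subseteq> (\<Union>i. C i) \<and> (\<forall>i. bounded (C i) \<and> diameter (C i) \<le> \<delta>)}"

definition hausdorff_content :: "nat \<Rightarrow> real \<Rightarrow> 'a::metric_space set \<Rightarrow> ennreal" where
  "hausdorff_content k \<delta> A = (INF C \<in> hausdorff_covers \<delta> A. \<Sum>i. hausdorff_weight k (C i))"

definition hausdorff_outer :: "nat \<Rightarrow> 'a::metric_space set \<Rightarrow> ennreal" where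
  "hausdorff_outer k A = (SUP \<delta>\<in>{0<..}. hausdorff_content k \<delta> A)"

definition manifold_measure :: "nat \<Rightarrow> 'a::metric_space set \<Rightarrow> 'a measure" where
  "manifold_measure k N =
     measure_of N (lambda_system N (Pow N) (hausdorff_outer k)) (hausdorff_outer k)"

lemma hausdorff_outer_empty: "hausdorff_outer k {} = 0"
proof -
  have "hausdorff_content k \<delta> ({} :: 'a::metric_space set) = 0" if "\<delta> > 0" for \<delta>
  proof -
    have "hausdorff_content k \<delta> ({} :: 'a set) \<le> (\<Sum>i::nat. hausdorff_weight k ({} :: 'a set))"
      unfolding hausdorff_content_def using that
      by (intro INF_lower2[of "\<lambda>_. {}"]) (auto simp: hausdorff_covers_def)
    then show ?thesis by (simp add: hausdorff_weight_def)
  qed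
  then show ?thesis
    unfolding hausdorff_outer_def by (auto intro!: antisym SUP_least)
qed

lemma hausdorff_outer_mono: "A \<subseteq> B \<Longrightarrow> hausdorff_outer k A \<le> hausdorff_outer k B"
  unfolding hausdorff_outer_def hausdorff_content_def
  by (intro SUP_mono bexI INF_superset_mono) (auto simp: hausdorff_covers_def)

lemma hausdorff_content_Union:
  "hausdorff_content k \<delta> (\<Union>i. A i) \<le> (\<Sum>i. hausdorff_content k \<delta> (A i))"
proof (rule ennreal_le_epsilon)
  fix e :: real
  assume "0 < e" "(\<Sum>n. hausdorff_content k \<delta> (A n)) < top"
  then have *: "hausdorff_content k \<delta> (A n) < hausdorff_content k \<delta> (A n) + e * (1/2)^Suc n" for n
    by (auto simp add: less_top dest!: ennreal_suminf_lessD)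
  have "\<exists>B\<in>hausdorff_covers \<delta> (A n).
      (\<Sum>i. hausdorff_weight k (B i)) \<le> hausdorff_content k \<delta> (A n) + e * (1/2)^Suc n" for n
    using *[of n] unfolding hausdorff_content_def INF_less_iff by (meson less_imp_le)
  then obtain B where B: "\<And>n. B n \<in> hausdorff_covers \<delta> (A n)"
    and Ble: "\<And>n. (\<Sum>i. hausdorff_weight k (B n i)) \<le> hausdorff_content k \<delta> (A n) + e * (1/2)^Suc n"
    by metis
  define C where "C = case_prod B o prod_decode"
  have sbB: "A n \<subseteq> (\<Union>i. B n i)" for n
    using B[of n] by (simp add: hausdorff_covers_def)
  have "(\<Union>i. A i) \<subseteq> (\<Union>i. C i)"
    using sbB by (auto simp add: C_def subset_eq) (metis prod.case prod_encode_inverse)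
  moreover have "bounded (C i) \<and> diameter (C i) \<le> \<delta>" for i
    using B by (auto simp: C_def hausdorff_covers_def split: prod.splits)
  ultimately have "hausdorff_content k \<delta> (\<Union>i. A i) \<le> (\<Sum>i. hausdorff_weight k (C i))"
    unfolding hausdorff_content_def by (intro INF_lower) (simp add: hausdorff_covers_def)
  also have "\<dots> = (\<Sum>i. (hausdorff_weight k o case_prod B) (prod_decode i))"
    by (simp add: C_def)
  also have "\<dots> = (\<Sum>n. \<Sum>i. hausdorff_weight k (B n i))"
    by (rule suminf_ennreal_2dimen) simp
  also have "\<dots> \<le> (\<Sum>n. hausdorff_content k \<delta> (A n) + e * (1/2) ^ Suc n)"
    by (intro suminf_le allI Ble) auto
  also have "\<dots> = (\<Sum>n. hausdorff_content k \<delta> (A n)) + (\<Sum>n. ennreal e * ennreal ((1/2) ^ Suc n))"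
    using \<open>0 < e\<close> by (subst suminf_add[symmetric])
      (auto simp del: ennreal_suminf_cmult simp add: ennreal_mult[symmetric])
  also have "\<dots> = (\<Sum>n. hausdorff_content k \<delta> (A n)) + e"
    unfolding ennreal_suminf_cmult
    by (subst suminf_ennreal_eq[OF zero_le_power power_half_series]) auto
  finally show "hausdorff_content k \<delta> (\<Union>i. A i) \<le> (\<Sum>n. hausdorff_content k \<delta> (A n)) + e" .
qed

lemma outer_measure_space_hausdorff: "outer_measure_space (Pow N) (hausdorff_outer k)"
proof -
  have "hausdorff_outer k (\<Union>i. A i) \<le> (\<Sum>i. hausdorff_outer k (A i))"
    for A :: "nat \<Rightarrow> 'a set"
  proof -
    have "hausdorff_content k \<delta> (\<Union>i. A i) \<le> (\<Sum>i. hausdorff_outer k (A i))"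
      if "\<delta> > 0" for \<delta>
    proof -
      have "(\<Sum>i. hausdorff_content k \<delta> (A i)) \<le> (\<Sum>i. hausdorff_outer k (A i))"
        using that by (intro suminf_le) (auto simp: hausdorff_outer_def intro: SUP_upper)
      then show ?thesis using hausdorff_content_Union[of k \<delta> A] by (rule order_trans[rotated])
    qed
    then show ?thesis by (auto simp: hausdorff_outer_def[of k "\<Union>i. A i"] intro!: SUP_least)
  qed
  then show ?thesis
    by (auto simp: outer_measure_space_def positive_def increasing_def countably_subadditive_def
        hausdorff_outer_empty hausdorff_outer_mono)
qed

lemma measure_space_hausdorff:
  "measure_space N (lambda_system N (Pow N) (hausdorff_outer k)) (hausdorff_outer k)"
  by (rule sigma_algebra.caratheodory_lemma[OF sigma_algebra_Pow outer_measure_space_hausdorff])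

lemma space_manifold_measure: "space (manifold_measure k N) = N"
  unfolding manifold_measure_def
  by (rule space_measure_of) (auto dest: lambda_system_sets)

lemma sets_manifold_measure:
  "sets (manifold_measure k N) = lambda_system N (Pow N) (hausdorff_outer k)"
  using measure_space_hausdorff[of N k] unfolding manifold_measure_def
  by (simp add: measure_space_def sigma_algebra.sets_measure_of_eq)

lemma emeasure_manifold_measure:
  assumes "A \<in> sets (manifold_measure k N)"
  shows "emeasure (manifold_measure k N) A = hausdorff_outer k A"
proof (rule emeasure_measure_of[OF manifold_measure_def])
  show "lambda_system N (Pow N) (hausdorff_outer k) \<subseteq> Pow N"
    by (auto dest: lambda_system_sets)
qed (use assms measure_space_hausdorff[of N k] in
      \<open>simp_all add: measure_space_def sets_manifold_measure\<close>)

lemma emeasure_manifold_measure_point: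
  "emeasure (manifold_measure 0 {p}) {p :: 'a::metric_space} = 1"
proof -
  have "hausdorff_content 0 \<delta> {p} = 1" if "\<delta> > 0" for \<delta>
  proof (rule antisym)
    have "hausdorff_content 0 \<delta> {p} \<le> (\<Sum>i::nat. hausdorff_weight 0 (if i = 0 then {p} else {}))"
      unfolding hausdorff_content_def using that
      by (intro INF_lower) (auto simp: hausdorff_covers_def)
    also have "\<dots> = (\<Sum>i\<in>{0::nat}. hausdorff_weight 0 (if i = 0 then {p} else {}))"
      by (rule suminf_finite) (auto simp: hausdorff_weight_def)
    also have "\<dots> = 1" by (simp add: hausdorff_weight_def)
    finally show "hausdorff_content 0 \<delta> {p} \<le> 1" .
  next
    show "1 \<le> hausdorff_content 0 \<delta> {p}"
      unfolding hausdorff_content_def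
    proof (rule INF_greatest)
      fix C assume "C \<in> hausdorff_covers \<delta> {p}"
      then obtain j where "p \<in> C j" by (auto simp: hausdorff_covers_def)
      then have "1 = (\<Sum>i\<in>{j}. hausdorff_weight 0 (C i))" by (auto simp: hausdorff_weight_def)
      also have "\<dots> \<le> (\<Sum>i. hausdorff_weight 0 (C i))" by (rule sum_le_suminf) auto
      finally show "1 \<le> (\<Sum>i. hausdorff_weight 0 (C i))" .
    qed
  qed
  then have "hausdorff_outer 0 {p} = 1" by (simp add: hausdorff_outer_def)
  moreover have "{p} \<in> sets (manifold_measure 0 {p})"
    using sets.top[of "manifold_measure 0 {p}"] by (simp add: space_manifold_measure)
  ultimately show ?thesis by (simp add: emeasure_manifold_measure)
qed

text \<open>
  A class modulo a.e. equality is represented by all its real-valued representatives: \<open>Y\<close> is a set of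
  measurable functions saturated under a.e. equality, and \<open>nrm\<close> is a seminorm on representatives
  whose null elements are those vanishing a.e. (monotonicity makes \<open>nrm\<close> constant on classes).
\<close>

definition ae_le :: "'a measure \<Rightarrow> ('a \<Rightarrow> real) \<Rightarrow> ('a \<Rightarrow> real) \<Rightarrow> bool" where
  "ae_le \<mu> x y \<longleftrightarrow> (AE t in \<mu>. x t \<le> y t)"

definition normed_lattice ::
  "'a measure \<Rightarrow> ('a \<Rightarrow> real) set \<Rightarrow> (('a \<Rightarrow> real) \<Rightarrow> real) \<Rightarrow> bool" where
  "normed_lattice \<mu> Y nrm \<longleftrightarrow>
     Y \<subseteq> borel_measurable \<mu> \<and>
     (\<forall>x\<in>Y. \<forall>y\<in>borel_measurable \<mu>. (AE t in \<mu>. x t = y t) \<longrightarrow> y \<in> Y) \<and>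
     (\<lambda>_. 0) \<in> Y \<and>
     (\<forall>x\<in>Y. \<forall>y\<in>Y. (\<lambda>t. x t + y t) \<in> Y) \<and>
     (\<forall>c. \<forall>x\<in>Y. (\<lambda>t. c * x t) \<in> Y) \<and>
     (\<forall>x\<in>Y. \<forall>y\<in>Y. \<exists>s\<in>Y. ae_le \<mu> x s \<and> ae_le \<mu> y s \<and>
        (\<forall>u\<in>Y. ae_le \<mu> x u \<longrightarrow> ae_le \<mu> y u \<longrightarrow> ae_le \<mu> s u)) \<and>
     (\<forall>x\<in>Y. \<forall>y\<in>Y. \<exists>s\<in>Y. ae_le \<mu> s x \<and> ae_le \<mu> s y \<and>
        (\<forall>u\<in>Y. ae_le \<mu> u x \<longrightarrow> ae_le \<mu> u y \<longrightarrow> ae_le \<mu> u s)) \<and>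
     (\<forall>x\<in>Y. 0 \<le> nrm x) \<and>
     (\<forall>x\<in>Y. nrm x = 0 \<longleftrightarrow> (AE t in \<mu>. x t = 0)) \<and>
     (\<forall>c. \<forall>x\<in>Y. nrm (\<lambda>t. c * x t) = \<bar>c\<bar> * nrm x) \<and>
     (\<forall>x\<in>Y. \<forall>y\<in>Y. nrm (\<lambda>t. x t + y t) \<le> nrm x + nrm y) \<and>
     (\<forall>x\<in>Y. \<forall>y\<in>Y. ae_le \<mu> (\<lambda>t. \<bar>x t\<bar>) (\<lambda>t. \<bar>y t\<bar>) \<longrightarrow> nrm x \<le> nrm y)"

definition ess_bounded :: "'a measure \<Rightarrow> ('a \<Rightarrow> real) set" where
  "ess_bounded \<mu> = {x \<in> borel_measurable \<mu>. \<exists>C. AE t in \<mu>. \<bar>x t\<bar> \<le> C}"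

definition modulus_of_continuity :: "(real \<Rightarrow> real) \<Rightarrow> bool" where
  "modulus_of_continuity \<omega> \<longleftrightarrow>
     continuous_on {0..} \<omega> \<and> mono_on {0..} \<omega> \<and> (\<forall>t\<ge>0. 0 \<le> \<omega> t) \<and> \<omega> 0 = 0 \<and>
     (\<forall>t\<ge>0. \<forall>t'\<ge>0. \<omega> (t + t') \<le> \<omega> t + \<omega> t')"

text \<open>
  Functions on an open set \<open>M\<close> with support in a compact \<open>M' \<subseteq> M\<close> are represented by their extensions
  by zero to the whole space. The support of a function given up to null sets is contained in
  the closed set \<open>M'\<close> iff the function vanishes a.e. off \<open>M'\<close>.
\<close>

definition Bclass :: "'a::euclidean_space set \<Rightarrow> ('a \<Rightarrow> real) set" where
  "Bclass M' = {x \<in> ess_bounded lebesgue. AE t in lebesgue. t \<notin> M' \<longrightarrow> x t = 0}"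

definition Htilde ::
  "'a::euclidean_space set \<Rightarrow> 'a set \<Rightarrow> (real \<Rightarrow> real) \<Rightarrow> ('a \<Rightarrow> real) set" where
  "Htilde M M' \<omega> = {x. continuous_on M x \<and> closure {t. x t \<noteq> 0} \<subseteq> M' \<and>
     (\<forall>t\<in>M'. \<forall>t'\<in>M'. \<bar>x t - x t'\<bar> \<le> \<omega> (dist t t'))}"

definition info :: "('n::finite \<Rightarrow> 'a) \<Rightarrow> ('a \<Rightarrow> real) \<Rightarrow> real ^ 'n" where
  "info q x = (\<chi> j. x (q j))"

definition error_box :: "real ^ 'n \<Rightarrow> (real ^ 'n) set" where
  "error_box e = {z. \<forall>j. - e $ j \<le> z $ j \<and> z $ j \<le> e $ j}"

text \<open>The boundary of \<open>M'\<close> relative to an open set \<open>M\<close> containing it is the ordinary \<open>frontier\<close>.\<close>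

definition tau ::
  "(real \<Rightarrow> real) \<Rightarrow> ('n::finite \<Rightarrow> 'a::euclidean_space) \<Rightarrow> real ^ 'n \<Rightarrow> 'a set \<Rightarrow> 'a \<Rightarrow> real" where
  "tau \<omega> q e M' t = (if t \<in> M' then Min (range (\<lambda>j. e $ j + \<omega> (dist t (q j)))) else 0)"

definition tau_tilde ::
  "(real \<Rightarrow> real) \<Rightarrow> ('n::finite \<Rightarrow> 'a::euclidean_space) \<Rightarrow> real ^ 'n \<Rightarrow> 'a set \<Rightarrow> 'a \<Rightarrow> real" where
  "tau_tilde \<omega> q e M' t = min (tau \<omega> q e M' t) (\<omega> (infdist t (frontier M')))"

definition Pi_pre ::
  "(real \<Rightarrow> real) \<Rightarrow> ('n::finite \<Rightarrow> 'a::euclidean_space) \<Rightarrow> real ^ 'n \<Rightarrow> 'a set \<Rightarrow> 'n \<Rightarrow> 'a set" where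
  "Pi_pre \<omega> q e M' j = {t \<in> M'. tau \<omega> q e M' t = e $ j + \<omega> (dist t (q j))}"

lemma wf_less_finite_linorder: "wf {(s :: 'n::{finite,linorder}, j). s < j}"
proof -
  have "trans {(s :: 'n, j). s < j}" by (auto simp: trans_def)
  then show ?thesis by (intro finite_acyclic_wf) (auto simp: acyclic_def trancl_id)
qed

function successive_diff :: "('n::{finite,linorder} \<Rightarrow> 'a set) \<Rightarrow> 'n \<Rightarrow> 'a set" where
  "successive_diff P j = P j - (\<Union>s\<in>{..<j}. successive_diff P s)"
  by pat_completeness auto
termination
  by (relation "inv_image {(s, j). s < j} snd") (auto intro: wf_less_finite_linorder)

declare successive_diff.simps [simp del]

definition Pi_tilde_0 ::
  "(real \<Rightarrow> real) \<Rightarrow> ('n::finite \<Rightarrow> 'a::euclidean_space) \<Rightarrow> real ^ 'n \<Rightarrow> 'a set \<Rightarrow> 'a set" where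
  "Pi_tilde_0 \<omega> q e M' = {t \<in> M'. \<omega> (infdist t (frontier M')) \<le> tau \<omega> q e M' t}"

definition Pi_tilde ::
  "(real \<Rightarrow> real) \<Rightarrow> ('n::{finite,linorder} \<Rightarrow> 'a::euclidean_space) \<Rightarrow> real ^ ('n::{finite,linorder})
    \<Rightarrow> 'a set \<Rightarrow> 'n \<Rightarrow> 'a set" where
  "Pi_tilde \<omega> q e M' j = successive_diff (Pi_pre \<omega> q e M') j - Pi_tilde_0 \<omega> q e M'"

text \<open>The cells \<open>Pi_tilde \<omega> q e M' j\<close> are pairwise disjoint, so at most one summand is nonzero.\<close>

definition L_tilde ::
  "(real \<Rightarrow> real) \<Rightarrow> ('n::{finite,linorder} \<Rightarrow> 'a::euclidean_space) \<Rightarrow> real ^ ('n::{finite,linorder}) \<Rightarrow> 'a set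
    \<Rightarrow> real ^ ('n::{finite,linorder}) \<Rightarrow> 'a \<Rightarrow> real" where
  "L_tilde \<omega> q e M' z t = (\<Sum>j\<in>UNIV. z $ j * indicator (Pi_tilde \<omega> q e M' j) t)"

definition recovery_error ::
  "(('p \<Rightarrow> real) \<Rightarrow> real) \<Rightarrow> ('x \<Rightarrow> 'p \<Rightarrow> real) \<Rightarrow> 'x set \<Rightarrow> ('x \<Rightarrow> 'z::plus) \<Rightarrow> 'z set
    \<Rightarrow> ('z \<Rightarrow> 'p \<Rightarrow> real) \<Rightarrow> ennreal" where
  "recovery_error nrm A W I U \<Phi> =
     (SUP x\<in>W. SUP z\<in>{I x + u | u. u \<in> U}. ennreal (nrm (\<lambda>p. A x p - \<Phi> z p)))"

definition optimal_error ::
  "('p \<Rightarrow> real) set \<Rightarrow> (('p \<Rightarrow> real) \<Rightarrow> real) \<Rightarrow> ('x \<Rightarrow> 'p \<Rightarrow> real) \<Rightarrow> 'x set \<Rightarrow> ('x \<Rightarrow> 'z::plus) \<Rightarrow> 'z set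
    \<Rightarrow> ennreal" where
  "optimal_error Y nrm A W I U = (INF \<Phi>\<in>{\<Phi>. range \<Phi> \<subseteq> Y}. recovery_error nrm A W I U \<Phi>)"

definition optimal_method ::
  "('p \<Rightarrow> real) set \<Rightarrow> (('p \<Rightarrow> real) \<Rightarrow> real) \<Rightarrow> ('x \<Rightarrow> 'p \<Rightarrow> real) \<Rightarrow> 'x set \<Rightarrow> ('x \<Rightarrow> 'z::plus) \<Rightarrow> 'z set
    \<Rightarrow> ('z \<Rightarrow> 'p \<Rightarrow> real) \<Rightarrow> bool" where
  "optimal_method Y nrm A W I U \<Phi> \<longleftrightarrow>
     range \<Phi> \<subseteq> Y \<and> recovery_error nrm A W I U \<Phi> = optimal_error Y nrm A W I U"

definition heat_domain :: "((real ^ 'd) \<times> real) set" where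
  "heat_domain = UNIV \<times> {0<..}"

definition heat_kernel :: "real ^ 'd \<Rightarrow> real \<Rightarrow> real" where
  "heat_kernel w t = exp (- (norm w)\<^sup>2 / (4 * t)) / (4 * pi * t) powr (real CARD('d) / 2)"

definition heat_source :: "((real ^ 'd) \<times> real \<Rightarrow> real) \<Rightarrow> (real ^ 'd) \<times> real \<Rightarrow> real" where
  "heat_source f = (\<lambda>(u, t).
     LINT (v, s) : UNIV \<times> {0<..<t} | lebesgue. heat_kernel (u - v) (t - s) * f (v, s))"

definition heat_initial :: "(real ^ 'd \<Rightarrow> real) \<Rightarrow> (real ^ 'd) \<times> real \<Rightarrow> real" where
  "heat_initial g = (\<lambda>(u, t). LINT v | lebesgue. heat_kernel (u - v) t * g v)"

definition heat_solution ::
  "((real ^ 'd) \<times> real \<Rightarrow> real) \<times> (real ^ 'd \<Rightarrow> real) \<Rightarrow> (real ^ 'd) \<times> real \<Rightarrow> real" where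
  "heat_solution = (\<lambda>(f, g) p. heat_source f p + heat_initial g p)"

end

theory Submission
  imports Defs "HOL-Probability.Distributions"
begin

text \<open>
  Every \<open>x\<close> in a class vanishes on the frontier of its support set, so its modulus bounds \<open>x t\<close> by
  the modulus at the distance to the frontier; near a node it is controlled by the noisy
  information. Hence \<open>\<bar>x - L z\<bar> \<le> \<tau>\<close> pointwise, and positivity of the heat kernel carries this bound
  over to \<open>\<bar>A x - A (L z)\<bar> \<le> A \<tau>\<close>. Conversely \<open>\<tau>\<close> and \<open>- \<tau>\<close> lie in the class and are both
  compatible with the information \<open>0\<close>, so a method is off by at least half of \<open>\<parallel>2 A \<tau>\<parallel>\<close> on one
  of them.
\<close>

section \<open>Moduli of continuity\<close>

lemma modulus_mono: "modulus_of_continuity \<omega> \<Longrightarrow> 0 \<le> a \<Longrightarrow> a \<le> b \<Longrightarrow> \<omega> a \<le> \<omega> b"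
  by (auto simp: modulus_of_continuity_def mono_on_def)

lemma modulus_nonneg: "modulus_of_continuity \<omega> \<Longrightarrow> 0 \<le> a \<Longrightarrow> 0 \<le> \<omega> a"
  by (simp add: modulus_of_continuity_def)

lemma modulus_zero: "modulus_of_continuity \<omega> \<Longrightarrow> \<omega> 0 = 0"
  by (simp add: modulus_of_continuity_def)

text \<open>Monotonicity and subadditivity bound the modulus of the larger argument by that of the
  smaller plus \<open>\<omega> c\<close>. Allowing any bound \<open>c\<close> on the difference lets
  \<open>dist\<close> and \<open>infdist\<close>, which are 1-Lipschitz, be inserted with
  \<open>c\<close> the distance of two points.\<close>

lemma modulus_diff_le:
  assumes "modulus_of_continuity \<omega>" "0 \<le> a" "0 \<le> b" "\<bar>a - b\<bar> \<le> c"
  shows "\<bar>\<omega> a - \<omega> b\<bar> \<le> \<omega> c"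
proof -
  have *: "\<omega> x - \<omega> y \<le> \<omega> c" if "0 \<le> x" "0 \<le> y" "\<bar>x - y\<bar> \<le> c" for x y
  proof -
    have "\<omega> x \<le> \<omega> (y + c)" using that by (intro modulus_mono[OF assms(1)]) auto
    also have "\<dots> \<le> \<omega> y + \<omega> c" using assms(1) that by (simp add: modulus_of_continuity_def)
    finally show ?thesis by simp
  qed
  show ?thesis using *[of a b] *[of b a] assms by (simp add: abs_le_iff abs_minus_commute)
qed

lemma continuous_on_modulus_comp:
  assumes "modulus_of_continuity \<omega>" "continuous_on S f" "\<And>t. t \<in> S \<Longrightarrow> 0 \<le> f t"
  shows "continuous_on S (\<lambda>t. \<omega> (f t))"
  using assms by (intro continuous_on_compose2[of "{0..}" \<omega> S f]) (auto simp: modulus_of_continuity_def)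

lemma continuous_on_of_modulus:
  fixes x :: "'a::metric_space \<Rightarrow> real"
  assumes "modulus_of_continuity \<omega>" "\<And>t t'. \<bar>x t - x t'\<bar> \<le> \<omega> (dist t t')"
  shows "continuous_on UNIV x"
proof -
  have "(x \<longlongrightarrow> x t) (at t)" for t
  proof (rule LIM_zero_cancel, rule Lim_null_comparison)
    show "\<forall>\<^sub>F t' in at t. norm (x t' - x t) \<le> \<omega> (dist t' t)" using assms(2) by simp
    have "continuous_on UNIV (\<lambda>t'. \<omega> (dist t' t))"
      by (intro continuous_on_modulus_comp[OF assms(1)] continuous_intros) auto
    then have "((\<lambda>t'. \<omega> (dist t' t)) \<longlongrightarrow> \<omega> (dist t t)) (at t)"
      unfolding continuous_on_def by blast
    then show "((\<lambda>t'. \<omega> (dist t' t)) \<longlongrightarrow> 0) (at t)"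
      by (simp add: modulus_zero[OF assms(1)])
  qed
  then show ?thesis by (simp add: continuous_on_def)
qed

text \<open>The segment from \<open>t\<close> to \<open>t'\<close> is connected and meets both
  \<open>S\<close> and its complement, so it crosses the frontier at a point no farther from
  \<open>t\<close> than \<open>t'\<close>. This controls increments between a point of the support
  set and a point outside it.\<close>

lemma infdist_frontier_le_dist:
  fixes t :: "'a::euclidean_space"
  assumes "t \<in> S" "t' \<notin> S"
  shows "infdist t (frontier S) \<le> dist t t'"
proof -
  have "closed_segment t t' \<inter> frontier S \<noteq> {}"
    using assms by (intro connected_Int_frontier) auto
  then obtain p where p: "p \<in> closed_segment t t'" "p \<in> frontier S" by blast
  have "infdist t (frontier S) \<le> dist t p" by (rule infdist_le[OF p(2)])
  also have "\<dots> \<le> dist t t'" using dist_in_closed_segment[OF p(1)] by (simp add: dist_commute)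
  finally show ?thesis .
qed

section \<open>The cells of the reconstruction\<close>

lemma successive_diff_subset: "successive_diff P j \<subseteq> P j"
  by (subst successive_diff.simps) auto

lemma successive_diff_disjoint_less:
  "i < j \<Longrightarrow> t \<in> successive_diff P i \<Longrightarrow> t \<notin> successive_diff P j"
  by (subst successive_diff.simps) auto

lemma successive_diff_disjoint:
  "t \<in> successive_diff P i \<Longrightarrow> t \<in> successive_diff P j \<Longrightarrow> i = j"
  using successive_diff_disjoint_less by (metis neqE)

text \<open>A point of \<open>P j\<close> missing from the \<open>j\<close>-th difference was
  removed because an earlier difference contains it.\<close>

lemma successive_diff_cover: "t \<in> P j \<Longrightarrow> \<exists>i. t \<in> successive_diff P i"
  using successive_diff.simps[of P j] by blast

lemma sets_successive_diff:
  assumes "\<And>j. P j \<in> sets M"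
  shows "successive_diff P j \<in> sets M"
  using assms
proof (induction P j rule: successive_diff.induct)
  case (1 P j)
  then show ?case
    by (subst successive_diff.simps) (intro sets.Diff sets.finite_UN, auto)
qed

text \<open>Source and initial data are treated alike: the ambient set \<open>M\<close> is later
  \<open>heat_domain\<close> for the former and the whole space for the latter.\<close>

locale recovery_class =
  fixes M M' :: "'a::euclidean_space set" and \<omega> :: "real \<Rightarrow> real"
    and q :: "'n::{finite,linorder} \<Rightarrow> 'a" and e :: "real ^ 'n::{finite,linorder}"
  assumes open_M: "open M" and compact_M': "compact M'" and sub: "M' \<subseteq> M"
    and modulus: "modulus_of_continuity \<omega>"
    and q_in: "range q \<subseteq> M'" and e_nonneg: "\<forall>j. 0 \<le> e $ j"
begin

lemma closed_M': "closed M'"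
  using compact_M' by (rule compact_imp_closed)

text \<open>The nodes make \<open>M'\<close> nonempty, and compactness keeps it from being the whole
  space. This rules out the convention that \<open>infdist\<close> to the empty set is 0, so a
  nearest frontier point exists.\<close>

lemma frontier_nonempty: "frontier M' \<noteq> {}"
  using compact_M' q_in not_bounded_UNIV
  by (intro frontier_not_empty) (auto dest: compact_imp_bounded)

section \<open>The extremal function \<open>tau_tilde\<close>\<close>

lemma tau_le: "t \<in> M' \<Longrightarrow> tau \<omega> q e M' t \<le> e $ j + \<omega> (dist t (q j))"
  by (auto simp: tau_def)

lemma tau_attained:
  assumes "t \<in> M'"
  obtains j where "tau \<omega> q e M' t = e $ j + \<omega> (dist t (q j))"
proof -
  have "Min (range (\<lambda>j. e $ j + \<omega> (dist t (q j)))) \<in> range (\<lambda>j. e $ j + \<omega> (dist t (q j)))"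
    by (intro Min_in) auto
  then obtain j where "Min (range (\<lambda>j. e $ j + \<omega> (dist t (q j)))) = e $ j + \<omega> (dist t (q j))"
    by (rule imageE)
  then show ?thesis using assms by (intro that[of j]) (simp add: tau_def)
qed

lemma tau_nonneg: "0 \<le> tau \<omega> q e M' t"
proof (cases "t \<in> M'")
  case True
  then obtain j where "tau \<omega> q e M' t = e $ j + \<omega> (dist t (q j))" by (rule tau_attained)
  then show ?thesis using e_nonneg modulus_nonneg[OF modulus] by simp
qed (simp add: tau_def)

text \<open>The node attaining the minimum at \<open>t'\<close> is also a candidate at
  \<open>t\<close>, where its value is larger by at most the modulus of the distance.\<close>

lemma tau_diff_le:
  assumes "t \<in> M'" "t' \<in> M'"
  shows "tau \<omega> q e M' t - tau \<omega> q e M' t' \<le> \<omega> (dist t t')"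
proof -
  obtain j where j: "tau \<omega> q e M' t' = e $ j + \<omega> (dist t' (q j))"
    using assms(2) by (rule tau_attained)
  \<comment> \<open>\<open>infdist\<close> to the singleton \<open>{q j}\<close> is
    \<open>dist\<close>, so \<open>infdist_triangle_abs\<close> supplies the reverse triangle
    inequality.\<close>
  have "\<bar>\<omega> (dist t (q j)) - \<omega> (dist t' (q j))\<bar> \<le> \<omega> (dist t t')"
    by (intro modulus_diff_le[OF modulus]) (use infdist_triangle_abs[of t "{q j}" t'] in simp_all)
  then show ?thesis using j tau_le[OF assms(1), of j] by simp
qed

lemma tau_tilde_nonneg: "0 \<le> tau_tilde \<omega> q e M' t"
  using tau_nonneg modulus_nonneg[OF modulus infdist_nonneg] by (simp add: tau_tilde_def)

lemma tau_tilde_outside: "t \<notin> M' \<Longrightarrow> tau_tilde \<omega> q e M' t = 0"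
  by (simp add: tau_tilde_def tau_def modulus_nonneg[OF modulus infdist_nonneg])

text \<open>Inside \<open>M'\<close> both terms of the minimum have modulus \<open>\<omega>\<close>.
  If only \<open>t\<close> lies in \<open>M'\<close>, the frontier term bounds the value at
  \<open>t\<close>, because the segment to \<open>t'\<close> crosses the frontier. Having the
  estimate for all pairs of points also yields continuity on the whole space.\<close>

lemma tau_tilde_diff_le: "\<bar>tau_tilde \<omega> q e M' t - tau_tilde \<omega> q e M' t'\<bar> \<le> \<omega> (dist t t')"
proof -
  have *: "tau_tilde \<omega> q e M' t - tau_tilde \<omega> q e M' t' \<le> \<omega> (dist t t')" for t t'
  proof -
    consider "t \<notin> M'" | "t \<in> M'" "t' \<in> M'" | "t \<in> M'" "t' \<notin> M'" by blast
    then show ?thesis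
    proof cases
      case 1
      then show ?thesis
        using tau_tilde_outside tau_tilde_nonneg[of t'] modulus_nonneg[OF modulus, of "dist t t'"]
        by simp
    next
      case 2
      have "\<bar>\<omega> (infdist t (frontier M')) - \<omega> (infdist t' (frontier M'))\<bar> \<le> \<omega> (dist t t')"
        by (intro modulus_diff_le[OF modulus]) (auto simp: infdist_triangle_abs infdist_nonneg)
      then show ?thesis using tau_diff_le[OF 2] by (simp add: tau_tilde_def)
    next
      case 3
      have "\<omega> (infdist t (frontier M')) \<le> \<omega> (dist t t')"
        by (intro modulus_mono[OF modulus] infdist_nonneg infdist_frontier_le_dist 3)
      then show ?thesis using tau_tilde_outside[OF 3(2)] by (simp add: tau_tilde_def)
    qed
  qed
  show ?thesis using *[of t t'] *[of t' t] by (simp add: abs_le_iff dist_commute)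
qed

lemma tau_tilde_in_Htilde: "tau_tilde \<omega> q e M' \<in> Htilde M M' \<omega>"
proof -
  have "continuous_on UNIV (tau_tilde \<omega> q e M')"
    using continuous_on_of_modulus[OF modulus tau_tilde_diff_le] .
  moreover have "closure {t. tau_tilde \<omega> q e M' t \<noteq> 0} \<subseteq> M'"
    using tau_tilde_outside by (intro closure_minimal closed_M') auto
  ultimately show ?thesis
    unfolding Htilde_def using tau_tilde_diff_le by (auto intro: continuous_on_subset)
qed

lemma uminus_Htilde: "x \<in> Htilde M M' \<omega> \<Longrightarrow> (\<lambda>t. - x t) \<in> Htilde M M' \<omega>"
  by (simp add: Htilde_def continuous_on_minus abs_minus_commute)

text \<open>At \<open>q j\<close> the \<open>j\<close>-th candidate of the minimum is
  \<open>e $ j + \<omega> 0\<close>, that is \<open>e $ j\<close>. Hence the information 0 is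
  compatible with both \<open>tau_tilde\<close> and its negative.\<close>

lemma tau_tilde_node: "\<bar>tau_tilde \<omega> q e M' (q j)\<bar> \<le> e $ j"
  using tau_tilde_nonneg[of "q j"] tau_le[of "q j" j] q_in modulus_zero[OF modulus]
  by (auto simp: tau_tilde_def image_subset_iff)

section \<open>Functions of the class: zero extension and decay towards the frontier\<close>

lemma Htilde_outside:
  assumes "x \<in> Htilde M M' \<omega>" "t \<notin> M'"
  shows "x t = 0"
  using assms closure_subset[of "{t. x t \<noteq> 0}"] by (auto simp: Htilde_def)

text \<open>The class demands continuity only on \<open>M\<close>. Off \<open>M'\<close> the
  function is constantly 0, and the open sets \<open>M\<close> and \<open>- M'\<close> cover the
  space.\<close>

lemma Htilde_continuous:
  assumes "x \<in> Htilde M M' \<omega>"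
  shows "continuous_on UNIV x"
proof -
  have "continuous_on (- M') x"
    by (rule continuous_on_eq[of _ "\<lambda>_. 0"]) (use Htilde_outside[OF assms] in auto)
  then have "continuous_on (M \<union> - M') x"
    using assms open_M closed_M' by (intro continuous_on_open_Un) (auto simp: Htilde_def)
  moreover have "M \<union> - M' = UNIV" using sub by auto
  ultimately show ?thesis by simp
qed

text \<open>At a nearest frontier point \<open>p\<close> the function vanishes, since it is
  continuous and zero on the complement of \<open>M'\<close>, whose closure contains
  \<open>p\<close>. As \<open>M'\<close> is closed, \<open>p\<close> belongs to it and the modulus
  condition applies to the pair \<open>t\<close>, \<open>p\<close>.\<close>

lemma Htilde_le_frontier:
  assumes x: "x \<in> Htilde M M' \<omega>" and t: "t \<in> M'"
  shows "\<bar>x t\<bar> \<le> \<omega> (infdist t (frontier M'))"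
proof -
  obtain p where p: "p \<in> frontier M'" "infdist t (frontier M') = dist t p"
    using infdist_attains_inf[OF frontier_closed frontier_nonempty] by metis
  have "continuous_on (closure (- M')) x"
    using Htilde_continuous[OF x] continuous_on_subset by blast
  moreover have "p \<in> closure (- M')" using p(1) by (simp add: frontier_closures)
  ultimately have "x p = 0"
    using Htilde_outside[OF x] by (intro continuous_constant_on_closure[of "- M'" x 0 p]) auto
  moreover have "p \<in> M'" using p(1) closed_M' frontier_subset_closed by blast
  ultimately show ?thesis using x t p(2) by (force simp: Htilde_def)
qed

lemma Htilde_subset_Bclass: "Htilde M M' \<omega> \<subseteq> Bclass M'"
proof
  fix x assume x: "x \<in> Htilde M M' \<omega>"
  have "compact (x ` M')"
    using Htilde_continuous[OF x] compact_M'
    by (intro compact_continuous_image) (auto intro: continuous_on_subset)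
  then obtain C where C: "\<And>t. t \<in> M' \<Longrightarrow> \<bar>x t\<bar> \<le> C"
    by (metis compact_imp_bounded bounded_iff imageI real_norm_def)
  \<comment> \<open>The maximum with 0 makes the bound valid off \<open>M'\<close> too, where
    \<open>x\<close> is 0.\<close>
  have "\<bar>x t\<bar> \<le> max C 0" for t
    using C[of t] Htilde_outside[OF x, of t] by (cases "t \<in> M'") auto
  moreover have "x \<in> borel_measurable lebesgue"
    using Htilde_continuous[OF x]
    by (intro measurable_completion) (simp add: borel_measurable_continuous_onI)
  ultimately show "x \<in> Bclass M'"
    using Htilde_outside[OF x] by (auto simp: Bclass_def ess_bounded_def intro!: exI[of _ "max C 0"])
qed

section \<open>The reconstruction: measurability, boundedness and pointwise error\<close>

lemma Pi_pre_borel: "Pi_pre \<omega> q e M' j \<in> sets borel"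
proof -
  \<comment> \<open>The minimum is attained at \<open>j\<close> exactly when the \<open>j\<close>-th
    candidate is below all others. This exhibits the cell as an intersection of closed sets.\<close>
  have "Pi_pre \<omega> q e M' j =
      M' \<inter> (\<Inter>i. {t. e $ j + \<omega> (dist t (q j)) \<le> e $ i + \<omega> (dist t (q i))})"
    unfolding Pi_pre_def
  proof (intro set_eqI, clarsimp, rule conj_cong[OF refl])
    fix t assume t: "t \<in> M'"
    show "tau \<omega> q e M' t = e $ j + \<omega> (dist t (q j)) \<longleftrightarrow>
        (\<forall>i. e $ j + \<omega> (dist t (q j)) \<le> e $ i + \<omega> (dist t (q i)))"
      using tau_le[OF t] tau_attained[OF t] by (metis antisym)
  qed
  moreover have "closed \<dots>"
    by (intro closed_Int closed_M' closed_INT ballI closed_Collect_le continuous_intros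
        continuous_on_modulus_comp[OF modulus]) auto
  ultimately show ?thesis by simp
qed

lemma Pi_tilde_0_borel: "Pi_tilde_0 \<omega> q e M' \<in> sets borel"
proof -
  have "Pi_tilde_0 \<omega> q e M' =
      M' \<inter> (\<Inter>i. {t. \<omega> (infdist t (frontier M')) \<le> e $ i + \<omega> (dist t (q i))})"
    by (auto simp: Pi_tilde_0_def tau_def)
  moreover have "closed \<dots>"
    by (intro closed_Int closed_M' closed_INT ballI closed_Collect_le continuous_intros
        continuous_on_modulus_comp[OF modulus]) (auto simp: infdist_nonneg)
  ultimately show ?thesis by simp
qed

lemma Pi_tilde_borel: "Pi_tilde \<omega> q e M' j \<in> sets borel"
  unfolding Pi_tilde_def
  by (intro sets.Diff sets_successive_diff Pi_pre_borel Pi_tilde_0_borel)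

lemma L_tilde_eq:
  assumes "t \<in> Pi_tilde \<omega> q e M' j"
  shows "L_tilde \<omega> q e M' z t = z $ j"
proof -
  have "L_tilde \<omega> q e M' z t = (\<Sum>i\<in>UNIV. if i = j then z $ j else 0)"
    unfolding L_tilde_def
  proof (intro sum.cong refl)
    fix i
    show "z $ i * indicator (Pi_tilde \<omega> q e M' i) t = (if i = j then z $ j else 0)"
    proof (cases "i = j")
      case False
      moreover have "t \<in> successive_diff (Pi_pre \<omega> q e M') j"
        using assms unfolding Pi_tilde_def by (rule DiffD1)
      ultimately have "t \<notin> successive_diff (Pi_pre \<omega> q e M') i"
        by (metis successive_diff_disjoint)
      then have "t \<notin> Pi_tilde \<omega> q e M' i"
        unfolding Pi_tilde_def by (metis DiffD1)
      then show ?thesis using False by simp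
    qed (use assms in simp)
  qed
  then show ?thesis by simp
qed

lemma L_tilde_eq_0: "(\<And>j. t \<notin> Pi_tilde \<omega> q e M' j) \<Longrightarrow> L_tilde \<omega> q e M' z t = 0"
  by (simp add: L_tilde_def)

lemma L_tilde_outside: "t \<notin> M' \<Longrightarrow> L_tilde \<omega> q e M' z t = 0"
  using successive_diff_subset[of "Pi_pre \<omega> q e M'"]
  by (intro L_tilde_eq_0) (auto simp: Pi_tilde_def Pi_pre_def)

lemma L_tilde_in_Bclass: "L_tilde \<omega> q e M' z \<in> Bclass M'"
proof -
  have "\<bar>L_tilde \<omega> q e M' z t\<bar> \<le> (\<Sum>j\<in>UNIV. \<bar>z $ j\<bar>)" for t
    unfolding L_tilde_def
    by (rule order_trans[OF sum_abs sum_mono]) (auto simp: indicator_def abs_mult)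
  moreover have "L_tilde \<omega> q e M' z \<in> borel_measurable lebesgue"
    unfolding L_tilde_def[abs_def] using Pi_tilde_borel
    by (intro measurable_completion borel_measurable_sum borel_measurable_times borel_measurable_const
        borel_measurable_indicator) simp
  ultimately show ?thesis
    using L_tilde_outside by (auto simp: Bclass_def ess_bounded_def)
qed

text \<open>The cells follow the branches of the minimum in \<open>tau_tilde\<close>. Where the
  frontier term is the smaller one, the reconstruction is 0 and the decay of \<open>x\<close>
  towards the frontier suffices. Elsewhere the error splits into the increment from \<open>t\<close>
  to \<open>q j\<close> and the data error at \<open>q j\<close>, whose bounds add up to
  \<open>tau\<close>.\<close>

lemma recovery_pointwise:
  assumes x: "x \<in> Htilde M M' \<omega>" and z: "\<And>j. \<bar>x (q j) - z $ j\<bar> \<le> e $ j"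
  shows "\<bar>x t - L_tilde \<omega> q e M' z t\<bar> \<le> tau_tilde \<omega> q e M' t"
proof (cases "t \<in> M'")
  case False
  then show ?thesis
    using Htilde_outside[OF x] L_tilde_outside tau_tilde_outside by simp
next
  case t: True
  show ?thesis
  proof (cases "t \<in> Pi_tilde_0 \<omega> q e M'")
    case True
    then have "L_tilde \<omega> q e M' z t = 0"
      by (intro L_tilde_eq_0) (simp add: Pi_tilde_def)
    then show ?thesis
      using Htilde_le_frontier[OF x t] True by (simp add: tau_tilde_def Pi_tilde_0_def)
  next
    case False
    \<comment> \<open>\<open>i\<close> is some index attaining the minimum; \<open>j\<close> is the
      one whose disjoint cell contains \<open>t\<close>. It attains the minimum as well, because
      that cell lies in \<open>Pi_pre\<close>.\<close>
    obtain i where "t \<in> Pi_pre \<omega> q e M' i"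
      using t tau_attained by (auto simp: Pi_pre_def)
    then obtain j where j: "t \<in> successive_diff (Pi_pre \<omega> q e M') j"
      using successive_diff_cover by meson
    then have tau: "tau \<omega> q e M' t = e $ j + \<omega> (dist t (q j))"
      using successive_diff_subset[of "Pi_pre \<omega> q e M'" j] by (auto simp: Pi_pre_def)
    have "L_tilde \<omega> q e M' z t = z $ j"
      using j False by (intro L_tilde_eq) (simp add: Pi_tilde_def)
    moreover have "\<bar>x t - x (q j)\<bar> \<le> \<omega> (dist t (q j))"
      using x t q_in by (auto simp: Htilde_def)
    ultimately have "\<bar>x t - L_tilde \<omega> q e M' z t\<bar> \<le> tau \<omega> q e M' t"
      using z[of j] tau by simp
    then show ?thesis using False t by (simp add: tau_tilde_def Pi_tilde_0_def)
  qed
qed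

end

section \<open>Integrability against the heat kernel\<close>

lemma heat_kernel_nonneg: "0 \<le> heat_kernel w t"
  by (simp add: heat_kernel_def)

lemma heat_kernel_measurable [measurable]:
  assumes [measurable]: "f \<in> borel_measurable M" "g \<in> borel_measurable M"
  shows "(\<lambda>x. heat_kernel (f x) (g x)) \<in> borel_measurable M"
  unfolding heat_kernel_def by measurable

text \<open>At time \<open>t\<close> the kernel is a Gaussian with independent coordinates of
  variance \<open>2 * t\<close>, so its total mass reduces to that of one-dimensional normal
  densities.\<close>

lemma heat_kernel_eq_prod_normal_density:
  fixes u v :: "real ^ 'd"
  assumes "0 < t"
  shows "heat_kernel (u - v) t = (\<Prod>b\<in>Basis. normal_density (u \<bullet> b) (sqrt (2 * t)) (v \<bullet> b))"
proof -
  have "(norm (u - v))\<^sup>2 = (\<Sum>b\<in>Basis. (v \<bullet> b - u \<bullet> b)\<^sup>2)"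
    by (subst norm_minus_commute, subst power2_norm_eq_inner, subst euclidean_inner)
      (simp add: inner_diff_left power2_eq_square)
  then have "exp (- (norm (u - v))\<^sup>2 / (4 * t)) =
      (\<Prod>b\<in>(Basis :: (real ^ 'd) set). exp (- (v \<bullet> b - u \<bullet> b)\<^sup>2 / (4 * t)))"
    by (simp add: exp_sum[symmetric] sum_negf sum_divide_distrib)
  moreover have "(4 * pi * t) powr (real CARD('d) / 2) = sqrt (4 * pi * t) ^ CARD('d)"
    using assms by (simp add: powr_half_sqrt[symmetric] powr_power)
  moreover have "normal_density a (sqrt (2 * t)) r = exp (- (r - a)\<^sup>2 / (4 * t)) / sqrt (4 * pi * t)" for a r
    using assms by (simp add: normal_density_def mult_ac)
  ultimately show ?thesis
    by (simp add: heat_kernel_def prod_dividef)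
qed

lemma nn_integral_heat_kernel:
  fixes u :: "real ^ 'd"
  assumes "0 < t"
  shows "(\<integral>\<^sup>+ v. heat_kernel (u - v) t \<partial>lborel) = 1"
proof -
  have "(\<integral>\<^sup>+ v. heat_kernel (u - v) t \<partial>lborel) =
      (\<integral>\<^sup>+ v. (\<Prod>b\<in>Basis. ennreal (normal_density (u \<bullet> b) (sqrt (2 * t)) (v \<bullet> b))) \<partial>lborel)"
    using assms by (simp add: heat_kernel_eq_prod_normal_density prod_ennreal)
  also have "\<dots> = (\<Prod>b\<in>(Basis :: (real ^ 'd) set).
      \<integral>\<^sup>+ r. ennreal (normal_density (u \<bullet> b) (sqrt (2 * t)) r) \<partial>lborel)"
    by (rule nn_integral_lborel_prod) auto
  also have "\<dots> = 1"
    using assms by (simp add: nn_integral_eq_integral)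
  finally show ?thesis .
qed

lemma integrable_heat_kernel:
  assumes "0 < t"
  shows "integrable lebesgue (\<lambda>v. heat_kernel (u - v) t)"
proof (rule integrableI_nonneg)
  show "(\<integral>\<^sup>+ v. heat_kernel (u - v) t \<partial>lebesgue) < \<infinity>"
    using nn_integral_heat_kernel[OF assms, of u] by (simp add: nn_integral_completion)
qed (auto intro!: measurable_completion simp: heat_kernel_nonneg)

lemma integrable_heat_kernel_time:
  "integrable lebesgue (\<lambda>p :: (real ^ 'd) \<times> real.
     indicator (UNIV \<times> {0<..<t}) p * heat_kernel (u - fst p) (t - snd p))" (is "integrable _ ?K")
proof (rule integrableI_nonneg)
  have [measurable]: "(UNIV :: (real ^ 'd) set) \<times> {0<..<t} \<in> sets borel"
    by (intro borel_open open_Times) auto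
  have K [measurable]: "?K \<in> borel_measurable borel"
    by (intro borel_measurable_times borel_measurable_indicator heat_kernel_measurable
        borel_measurable_diff borel_measurable_const borel_measurable_continuous_onI
        continuous_on_fst continuous_on_snd continuous_on_id) measurable
  then show "?K \<in> borel_measurable lebesgue" by (intro measurable_completion) simp
  show "AE p in lebesgue. 0 \<le> ?K p" by (simp add: heat_kernel_nonneg)
  have "(\<integral>\<^sup>+ p. ?K p \<partial>lebesgue) = (\<integral>\<^sup>+ p. ?K p \<partial>(lborel \<Otimes>\<^sub>M lborel))"
    by (simp add: nn_integral_completion lborel_prod)
  \<comment> \<open>Integrating in space first gives each time slice in the interval mass 1, so the
    singularity at \<open>s = t\<close> is harmless and the total is the length of the
    interval.\<close>
  also have "\<dots> = (\<integral>\<^sup>+ s. \<integral>\<^sup>+ v. ?K (v, s) \<partial>lborel \<partial>lborel)"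
    by (rule lborel_pair.nn_integral_snd[symmetric]) (use K in \<open>simp add: lborel_prod\<close>)
  also have "\<dots> = (\<integral>\<^sup>+ s. indicator {0<..<t} s \<partial>lborel)"
  proof (rule nn_integral_cong)
    fix s :: real
    show "(\<integral>\<^sup>+ v. ?K (v, s) \<partial>lborel) = indicator {0<..<t} s"
      by (cases "s \<in> {0<..<t}") (simp_all add: nn_integral_heat_kernel)
  qed
  also have "\<dots> < \<infinity>" by (simp add: emeasure_bounded_finite[unfolded infinity_ennreal_def])
  finally show "(\<integral>\<^sup>+ p. ?K p \<partial>lebesgue) < \<infinity>" .
qed

section \<open>Positivity of the heat operators\<close>

lemma integrable_mult_ess_bounded:
  assumes "integrable M K" "x \<in> ess_bounded M"
  shows "integrable M (\<lambda>t. K t * x t)"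
proof -
  obtain C where C: "AE t in M. \<bar>x t\<bar> \<le> C" and [measurable]: "x \<in> borel_measurable M"
    using assms(2) by (auto simp: ess_bounded_def)
  have [measurable]: "K \<in> borel_measurable M" using assms(1) by auto
  show ?thesis
  proof (rule Bochner_Integration.integrable_bound)
    show "integrable M (\<lambda>t. C * K t)" using assms(1) by simp
    show "AE t in M. norm (K t * x t) \<le> norm (C * K t)"
      using C
    proof eventually_elim
      case (elim t)
      then have "\<bar>K t\<bar> * \<bar>x t\<bar> \<le> \<bar>K t\<bar> * \<bar>C\<bar>" by (intro mult_left_mono) auto
      then show ?case by (simp add: abs_mult mult.commute)
    qed
  qed measurable
qed

text \<open>A nonnegative kernel preserves pointwise domination. Essential boundedness makes all the
  integrals genuine, so linearity applies rather than the default value 0 of a non-integrable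
  function.\<close>

lemma integral_diff_abs_le:
  fixes K :: "'a \<Rightarrow> real"
  assumes "integrable M K" "\<And>t. 0 \<le> K t" "x \<in> ess_bounded M" "y \<in> ess_bounded M"
    "w \<in> ess_bounded M" "\<And>t. \<bar>x t - y t\<bar> \<le> w t"
  shows "\<bar>(LINT t|M. K t * x t) - (LINT t|M. K t * y t)\<bar> \<le> (LINT t|M. K t * w t)"
proof -
  note int = integrable_mult_ess_bounded[OF assms(1)]
  have "(LINT t|M. K t * x t) - (LINT t|M. K t * y t) = (LINT t|M. K t * (x t - y t))"
    using int[OF assms(3)] int[OF assms(4)] by (simp add: right_diff_distrib)
  also have "\<bar>\<dots>\<bar> \<le> (LINT t|M. \<bar>K t * (x t - y t)\<bar>)"
    by (rule integral_abs_bound)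
  also have "\<dots> \<le> (LINT t|M. K t * w t)"
  proof (rule integral_mono)
    show "integrable M (\<lambda>t. \<bar>K t * (x t - y t)\<bar>)"
      using int[OF assms(3)] int[OF assms(4)] by (simp add: right_diff_distrib)
    show "integrable M (\<lambda>t. K t * w t)" by (rule int[OF assms(5)])
    show "\<bar>K t * (x t - y t)\<bar> \<le> K t * w t" for t
      using assms(2,6) by (simp add: abs_mult mult_left_mono)
  qed
  finally show ?thesis .
qed

text \<open>The time cutoff is absorbed into the kernel, giving the form of a single nonnegative
  kernel integrated against \<open>f\<close>.\<close>

lemma heat_source_eq:
  "heat_source f (u, t) = (LINT p|lebesgue.
     (indicator (UNIV \<times> {0<..<t}) p * heat_kernel (u - fst p) (t - snd p)) * f p)"
  by (simp add: heat_source_def set_lebesgue_integral_def case_prod_beta mult.assoc)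

lemma heat_source_diff_le:
  assumes "f \<in> Bclass S" "g \<in> Bclass S" "h \<in> Bclass S" "\<And>p. \<bar>f p - g p\<bar> \<le> h p"
  shows "\<bar>heat_source f p - heat_source g p\<bar> \<le> heat_source h p"
  using assms unfolding Bclass_def
  by (cases p) (auto simp only: heat_source_eq mem_Collect_eq intro!: integral_diff_abs_le
      integrable_heat_kernel_time mult_nonneg_nonneg heat_kernel_nonneg indicator_pos_le)

text \<open>Membership of \<open>p\<close> in \<open>heat_domain\<close> means positive time, where
  the kernel is integrable in space.\<close>

lemma heat_initial_diff_le:
  assumes "f \<in> Bclass S" "g \<in> Bclass S" "h \<in> Bclass S" "\<And>v. \<bar>f v - g v\<bar> \<le> h v" "p \<in> heat_domain"
  shows "\<bar>heat_initial f p - heat_initial g p\<bar> \<le> heat_initial h p"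
  using assms unfolding Bclass_def heat_domain_def heat_initial_def
  by (auto intro!: integral_diff_abs_le integrable_heat_kernel heat_kernel_nonneg)

lemma heat_source_uminus: "heat_source (\<lambda>p. - f p) p = - heat_source f p"
  by (cases p) (simp add: heat_source_eq)

lemma heat_initial_uminus: "heat_initial (\<lambda>v. - g v) p = - heat_initial g p"
  by (cases p) (simp add: heat_initial_def)

section \<open>Optimal recovery\<close>

lemma open_heat_domain: "open heat_domain"
  unfolding heat_domain_def by (intro open_Times) auto

theorem corollary7:
  fixes N :: "((real ^ 'd) \<times> real) set" and k :: nat
    and M1 :: "((real ^ 'd) \<times> real) set" and M2 :: "(real ^ 'd) set"
    and \<omega>1 \<omega>2 :: "real \<Rightarrow> real"
    and q1 :: "'n1::{finite,linorder} \<Rightarrow> (real ^ 'd) \<times> real"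
    and q2 :: "'n2::{finite,linorder} \<Rightarrow> real ^ 'd"
    and e1 :: "real ^ ('n1::{finite,linorder})" and e2 :: "real ^ ('n2::{finite,linorder})"
    and Y :: "((real ^ 'd) \<times> real \<Rightarrow> real) set"
    and nrm :: "((real ^ 'd) \<times> real \<Rightarrow> real) \<Rightarrow> real"
  assumes "C1_submanifold k N" and "N \<subseteq> heat_domain"
    and "compact M1" and "M1 \<subseteq> heat_domain" and "compact M2"
    and "modulus_of_continuity \<omega>1" and "modulus_of_continuity \<omega>2"
    and "inj q1" and "range q1 \<subseteq> M1" and "inj q2" and "range q2 \<subseteq> M2"
    and "\<forall>j. 0 \<le> e1 $ j" and "\<forall>j. 0 \<le> e2 $ j"
    and "normed_lattice (manifold_measure k N) Y nrm"
    and "{y \<in> ess_bounded (manifold_measure k N). integrable (manifold_measure k N) y} \<subseteq> Y"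
    and "heat_source ` Bclass M1 \<subseteq> Y" and "heat_initial ` Bclass M2 \<subseteq> Y"
  shows "let A = heat_solution;
             W = Htilde heat_domain M1 \<omega>1 \<times> Htilde UNIV M2 \<omega>2;
             I = map_prod (info q1) (info q2);
             U = error_box e1 \<times> error_box e2;
             L = map_prod (L_tilde \<omega>1 q1 e1 M1) (L_tilde \<omega>2 q2 e2 M2);
             \<tau> = (tau_tilde \<omega>1 q1 e1 M1, tau_tilde \<omega>2 q2 e2 M2);
             \<Phi> = A \<circ> L
         in optimal_method Y nrm A W I U \<Phi> \<and>
            optimal_error Y nrm A W I U = recovery_error nrm A W I U \<Phi> \<and>
            recovery_error nrm A W I U \<Phi> = ennreal (nrm (A \<tau>))"
proof -
  let ?\<mu> = "manifold_measure k N"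
  let ?W = "Htilde heat_domain M1 \<omega>1 \<times> Htilde UNIV M2 \<omega>2"
  let ?I = "map_prod (info q1) (info q2)"
  let ?U = "error_box e1 \<times> error_box e2"
  let ?\<tau>1 = "tau_tilde \<omega>1 q1 e1 M1" and ?\<tau>2 = "tau_tilde \<omega>2 q2 e2 M2"
  let ?\<Phi> = "heat_solution \<circ> map_prod (L_tilde \<omega>1 q1 e1 M1) (L_tilde \<omega>2 q2 e2 M2)"
  let ?A\<tau> = "heat_solution (?\<tau>1, ?\<tau>2)"
  interpret R1: recovery_class heat_domain M1 \<omega>1 q1 e1
    using assms by unfold_locales (auto simp: open_heat_domain)
  interpret R2: recovery_class UNIV M2 \<omega>2 q2 e2
    using assms by unfold_locales auto

  have Y: "Y \<subseteq> borel_measurable ?\<mu>"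
      "\<And>x y. x \<in> Y \<Longrightarrow> y \<in> Y \<Longrightarrow> (\<lambda>t. x t + y t) \<in> Y"
      "\<And>c x. x \<in> Y \<Longrightarrow> (\<lambda>t. c * x t) \<in> Y"
      "\<And>c x. x \<in> Y \<Longrightarrow> nrm (\<lambda>t. c * x t) = \<bar>c\<bar> * nrm x"
      "\<And>x y. x \<in> Y \<Longrightarrow> y \<in> Y \<Longrightarrow> nrm (\<lambda>t. x t + y t) \<le> nrm x + nrm y"
      "\<And>x y. x \<in> Y \<Longrightarrow> y \<in> Y \<Longrightarrow> ae_le ?\<mu> (\<lambda>t. \<bar>x t\<bar>) (\<lambda>t. \<bar>y t\<bar>) \<Longrightarrow> nrm x \<le> nrm y"
    using \<open>normed_lattice ?\<mu> Y nrm\<close> unfolding normed_lattice_def by simp_all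
  have Ydiff: "(\<lambda>t. x t - y t) \<in> Y" if "x \<in> Y" "y \<in> Y" for x y
    using Y(2)[OF that(1) Y(3)[OF that(2), of "-1"]] by simp
  have A_in_Y: "heat_solution (f, g) \<in> Y" if "f \<in> Bclass M1" "g \<in> Bclass M2" for f g
    using that assms(16,17) Y(2)[of "heat_source f" "heat_initial g"]
    by (auto simp: heat_solution_def)
  have \<tau>_in_Y: "?A\<tau> \<in> Y"
    using A_in_Y R1.Htilde_subset_Bclass R1.tau_tilde_in_Htilde
      R2.Htilde_subset_Bclass R2.tau_tilde_in_Htilde by blast
  have range_\<Phi>: "range ?\<Phi> \<subseteq> Y"
    using A_in_Y R1.L_tilde_in_Bclass R2.L_tilde_in_Bclass by auto

  \<comment> \<open>Upper bound: pointwise domination on \<open>N\<close> becomes a bound of norms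
    because the norm of a lattice is monotone.\<close>
  have upper: "recovery_error nrm heat_solution ?W ?I ?U ?\<Phi> \<le> ennreal (nrm ?A\<tau>)"
    unfolding recovery_error_def
  proof (intro SUP_least ennreal_leI)
    fix x z assume "x \<in> ?W" and "z \<in> {?I x + u |u. u \<in> ?U}"
    then obtain f g u1 u2 where x: "x = (f, g)"
      and f: "f \<in> Htilde heat_domain M1 \<omega>1" and g: "g \<in> Htilde UNIV M2 \<omega>2"
      and u: "u1 \<in> error_box e1" "u2 \<in> error_box e2"
      and z: "z = (info q1 f + u1, info q2 g + u2)"
      by auto
    let ?Lf = "L_tilde \<omega>1 q1 e1 M1 (info q1 f + u1)" and ?Lg = "L_tilde \<omega>2 q2 e2 M2 (info q2 g + u2)"
    have f': "\<bar>f p - ?Lf p\<bar> \<le> ?\<tau>1 p" for p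
      using u(1) by (intro R1.recovery_pointwise f) (auto simp: info_def error_box_def abs_le_iff minus_le_iff)
    have g': "\<bar>g v - ?Lg v\<bar> \<le> ?\<tau>2 v" for v
      using u(2) by (intro R2.recovery_pointwise g) (auto simp: info_def error_box_def abs_le_iff minus_le_iff)
    have B: "f \<in> Bclass M1" "g \<in> Bclass M2" "?Lf \<in> Bclass M1" "?Lg \<in> Bclass M2"
        "?\<tau>1 \<in> Bclass M1" "?\<tau>2 \<in> Bclass M2"
      using f g R1.Htilde_subset_Bclass R1.tau_tilde_in_Htilde R1.L_tilde_in_Bclass
        R2.Htilde_subset_Bclass R2.tau_tilde_in_Htilde R2.L_tilde_in_Bclass by auto
    show "nrm (\<lambda>p. heat_solution x p - ?\<Phi> z p) \<le> nrm ?A\<tau>"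
    proof (rule Y(6))
      show "(\<lambda>p. heat_solution x p - ?\<Phi> z p) \<in> Y"
        using A_in_Y[OF B(1,2)] range_\<Phi> x by (intro Ydiff) auto
      show "ae_le ?\<mu> (\<lambda>p. \<bar>heat_solution x p - ?\<Phi> z p\<bar>) (\<lambda>p. \<bar>?A\<tau> p\<bar>)"
        unfolding ae_le_def
      proof (rule AE_I2)
        fix p assume "p \<in> space ?\<mu>"
        then have p: "p \<in> heat_domain" using assms(2) by (auto simp: space_manifold_measure)
        show "\<bar>heat_solution x p - ?\<Phi> z p\<bar> \<le> \<bar>?A\<tau> p\<bar>"
          using heat_source_diff_le[OF B(1,3,5) f', of p]
            heat_initial_diff_le[OF B(2,4,6) g' p]
          by (simp add: x z heat_solution_def)
      qed
    qed (rule \<tau>_in_Y)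
  qed

  \<comment> \<open>Lower bound: a method receiving the information 0 returns one and the same
    answer for the extremal pair and for its negative.\<close>
  have lower: "ennreal (nrm ?A\<tau>) \<le> recovery_error nrm heat_solution ?W ?I ?U \<Psi>"
    if "range \<Psi> \<subseteq> Y" for \<Psi>
  proof -
    let ?m\<tau> = "(\<lambda>t. - ?\<tau>1 t, \<lambda>t. - ?\<tau>2 t)"
    \<comment> \<open>Choosing the data error \<open>- ?I x\<close> cancels the exact information,
      so \<open>\<Psi> 0\<close> has to serve every such \<open>x\<close>.\<close>
    have err: "ennreal (nrm (\<lambda>p. heat_solution x p - \<Psi> 0 p)) \<le> recovery_error nrm heat_solution ?W ?I ?U \<Psi>"
      if "x \<in> ?W" "- ?I x \<in> ?U" for x
    proof -
      have "0 = ?I x + - ?I x" by simp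
      then have "0 \<in> {?I x + u |u. u \<in> ?U}"
        using that(2) by (intro CollectI exI[of _ "- ?I x"] conjI)
      then show ?thesis unfolding recovery_error_def using that(1)
        by (intro SUP_upper2[of x] SUP_upper) simp_all
    qed
    have plus: "ennreal (nrm (\<lambda>p. ?A\<tau> p - \<Psi> 0 p)) \<le> recovery_error nrm heat_solution ?W ?I ?U \<Psi>"
      using R1.tau_tilde_in_Htilde R2.tau_tilde_in_Htilde R1.tau_tilde_node R2.tau_tilde_node
      by (intro err) (auto simp: info_def error_box_def abs_le_iff minus_le_iff)
    have minus: "ennreal (nrm (\<lambda>p. heat_solution ?m\<tau> p - \<Psi> 0 p)) \<le> recovery_error nrm heat_solution ?W ?I ?U \<Psi>"
      using R1.tau_tilde_in_Htilde R2.tau_tilde_in_Htilde R1.tau_tilde_node R2.tau_tilde_node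
      by (intro err) (auto simp: info_def error_box_def abs_le_iff minus_le_iff
          intro: R1.uminus_Htilde R2.uminus_Htilde)
    have A_minus: "heat_solution ?m\<tau> = (\<lambda>p. - ?A\<tau> p)"
      by (simp add: heat_solution_def heat_source_uminus heat_initial_uminus algebra_simps)
    have \<Psi>: "\<Psi> 0 \<in> Y" using that by auto
    have D: "(\<lambda>p. ?A\<tau> p - \<Psi> 0 p) \<in> Y" "(\<lambda>p. ?A\<tau> p + \<Psi> 0 p) \<in> Y"
      using \<tau>_in_Y \<Psi> by (auto intro: Ydiff Y(2))
    \<comment> \<open>The second summand is, up to sign, the error of \<open>\<Psi> 0\<close> at the
      negative pair. By the triangle inequality the two errors sum to at least twice the norm, so
      one of them reaches it.\<close>
    have "2 * nrm ?A\<tau> = nrm (\<lambda>p. (?A\<tau> p - \<Psi> 0 p) + (?A\<tau> p + \<Psi> 0 p))"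
      using Y(4)[OF \<tau>_in_Y, of 2] by simp
    also have "\<dots> \<le> nrm (\<lambda>p. ?A\<tau> p - \<Psi> 0 p) + nrm (\<lambda>p. ?A\<tau> p + \<Psi> 0 p)"
      by (rule Y(5)[OF D])
    also have "nrm (\<lambda>p. ?A\<tau> p + \<Psi> 0 p) = nrm (\<lambda>p. heat_solution ?m\<tau> p - \<Psi> 0 p)"
      using Y(4)[OF D(2), of "-1"] by (simp add: A_minus)
    finally have "nrm ?A\<tau> \<le> nrm (\<lambda>p. ?A\<tau> p - \<Psi> 0 p) \<or>
        nrm ?A\<tau> \<le> nrm (\<lambda>p. heat_solution ?m\<tau> p - \<Psi> 0 p)"
      by linarith
    then show ?thesis using plus minus by (meson ennreal_leI order_trans)
  qed

  have opt: "optimal_error Y nrm heat_solution ?W ?I ?U = ennreal (nrm ?A\<tau>)"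
    unfolding optimal_error_def
  proof (rule antisym)
    show "(INF \<Psi>\<in>{\<Psi>. range \<Psi> \<subseteq> Y}. recovery_error nrm heat_solution ?W ?I ?U \<Psi>) \<le> ennreal (nrm ?A\<tau>)"
      using range_\<Phi> by (intro INF_lower2[of ?\<Phi>] upper) simp
    show "ennreal (nrm ?A\<tau>) \<le> (INF \<Psi>\<in>{\<Psi>. range \<Psi> \<subseteq> Y}. recovery_error nrm heat_solution ?W ?I ?U \<Psi>)"
      using lower by (intro INF_greatest) simp
  qed
  \<comment> \<open>\<open>?\<Phi>\<close> takes values in \<open>Y\<close>, so the lower bound for
    arbitrary methods applies to it too.\<close>
  have "recovery_error nrm heat_solution ?W ?I ?U ?\<Phi> = ennreal (nrm ?A\<tau>)"
    using upper lower[OF range_\<Phi>] by (rule antisym)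
  then show ?thesis
    using opt range_\<Phi> by (simp add: optimal_method_def Let_def)
qed

end
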